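(* Let $q$ and $k$ be nonnegative integers, let $\alpha$ be a real number, and let $G$ be a balanced bipartite graph with $|V(G)|=2n\ge 6k+8$. If $\delta(G)\ge k\ge q+1$ and if both $\Theta(G,\alpha)>\Theta_0(q+1)$ and $0\le\alpha\le1$, then $G$ is $(q,q)$-Hamiltonian unless $G\subseteq F_{n,k,q+1}$.
   Context: Graphs are finite, simple and undirected; the subgraph relation $\subseteq$ between graphs is up to isomorphism. A bipartite graph $G=[U,V]$ is balanced if $|U|=|V|$. $\delta(G)$ is the minimum degree. For real $\alpha\ge0$, $\Theta(G,\alpha)$ is the largest eigenvalue of $A(G)+\alpha D(G)$, where $A(G)$ is the adjacency matrix and $D(G)$ the diagonal degree matrix. For an integer $s$ define $$\varepsilon_0(s)=n(n+s-k-2)+(k+1)(k+2-s),\qquad \Theta_0(s)=\alpha\left(\frac{\varepsilon_0(s)}{n}+n\right)+(1-\alpha)\sqrt{\varepsilon_0(s)}.$$ A balanced bipartite graph $G=[U,V]$ is $(q,q)$-Hamiltonian if for every $S\subset V(G)$ with $|S\cap U|=|S\cap V|=q$, the graph $G-S$ contains a spanning cycle. For integers $n>k\ge 0$, $a\ge k+1$, $b\ge1$, let $(X,Y)$ be the bipartition of $K_{n,a+b}$ with $|X|=n$, $|Y|=a+b$, let $X_1\subset X$ with $|X_1|=n-k$ and $Y_1\subset Y$ with $|Y_1|=b$. Then $Z_{a,b}$ (depending also on $n,k$) is the graph obtained from $K_{n,a+b}$ by deleting all edges between $X_1$ and $Y_1$. Define $F_{n,k,s}=Z_{n+s-k-1,\,k+1-s}$.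 *)

theory Defs
  imports
    "HOL-Analysis.Analysis"
    "Graph_Theory.Graph_Theory"
    "Jordan_Normal_Form.Spectral_Radius"
begin

text \<open>
  A finite simple undirected graph is a \<open>pair_graph\<close>: a finite loop-free digraph whose arcs are
  pairs of vertices and form a symmetric relation, so an edge \<open>uv\<close> is the two arcs
  \<open>(u,v)\<close> and \<open>(v,u)\<close>, and the degree of a vertex is its \<open>out_degree\<close>.
\<close>

definition balanced_bipartite :: "'a pair_pre_digraph \<Rightarrow> 'a set \<Rightarrow> 'a set \<Rightarrow> bool" where
  "balanced_bipartite G U V \<longleftrightarrow>
     pair_graph G \<and> U \<union> V = pverts G \<and> U \<inter> V = {} \<and>
     parcs G \<subseteq> (U \<times> V) \<union> (V \<times> U) \<and> card U = card V"

definition min_degree :: "'a pair_pre_digraph \<Rightarrow> nat" where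
  "min_degree G = Min (out_degree (with_proj G) ` pverts G)"

definition delete_vertices :: "'a pair_pre_digraph \<Rightarrow> 'a set \<Rightarrow> 'a pair_pre_digraph" where
  "delete_vertices G S =
     \<lparr> pverts = pverts G - S, parcs = {e \<in> parcs G. fst e \<notin> S \<and> snd e \<notin> S} \<rparr>"

text \<open>
  In a symmetric digraph the library's notion of cycle admits the walk \<open>u, v, u\<close> along a single
  edge; the bound on the length excludes it.
\<close>

definition has_spanning_cycle :: "'a pair_pre_digraph \<Rightarrow> bool" where
  "has_spanning_cycle G \<longleftrightarrow>
     (\<exists>p. pre_digraph.cycle (with_proj G) p \<and> 3 \<le> length p \<and> fst ` set p = pverts G)"

definition qq_Hamiltonian :: "nat \<Rightarrow> 'a pair_pre_digraph \<Rightarrow> 'a set \<Rightarrow> 'a set \<Rightarrow> bool" where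
  "qq_Hamiltonian q G U V \<longleftrightarrow>
     (\<forall>S \<subseteq> pverts G. card (S \<inter> U) = q \<and> card (S \<inter> V) = q \<longrightarrow>
        has_spanning_cycle (delete_vertices G S))"

definition subgraph_up_to_iso :: "'a pair_pre_digraph \<Rightarrow> 'b pair_pre_digraph \<Rightarrow> bool" where
  "subgraph_up_to_iso G F \<longleftrightarrow>
     (\<exists>H :: 'b pair_pre_digraph.
        subgraph (with_proj H) (with_proj F) \<and> digraph_iso (with_proj G) (with_proj H))"

text \<open>
  The matrices are indexed by positions in a list \<open>vs\<close> enumerating the vertices.
\<close>

definition adjacency_matrix :: "'a pair_pre_digraph \<Rightarrow> 'a list \<Rightarrow> real mat" where
  "adjacency_matrix G vs =
     mat (length vs) (length vs) (\<lambda>(i, j). if (vs ! i, vs ! j) \<in> parcs G then 1 else 0)"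

definition degree_matrix :: "'a pair_pre_digraph \<Rightarrow> 'a list \<Rightarrow> real mat" where
  "degree_matrix G vs =
     mat (length vs) (length vs)
       (\<lambda>(i, j). if i = j then real (out_degree (with_proj G) (vs ! i)) else 0)"

definition vertex_list :: "'a pair_pre_digraph \<Rightarrow> 'a list" where
  "vertex_list G = (SOME vs. distinct vs \<and> set vs = pverts G)"

text \<open>
  For a graph with at least one vertex the matrix is real symmetric, so its set of real
  eigenvalues is finite and nonempty; by \<open>eigenvalue_vertex_indexed\<close> below
  it does not depend on the chosen enumeration.
\<close>

definition Theta :: "'a pair_pre_digraph \<Rightarrow> real \<Rightarrow> real" where
  "Theta G \<alpha> =
     Max (spectrum (adjacency_matrix G (vertex_list G) + \<alpha> \<cdot>\<^sub>m degree_matrix G (vertex_list G)))"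

definition epsilon0 :: "nat \<Rightarrow> nat \<Rightarrow> int \<Rightarrow> int" where
  "epsilon0 n k s = int n * (int n + s - int k - 2) + (int k + 1) * (int k + 2 - s)"

definition Theta0 :: "real \<Rightarrow> nat \<Rightarrow> nat \<Rightarrow> int \<Rightarrow> real" where
  "Theta0 \<alpha> n k s =
     \<alpha> * (real_of_int (epsilon0 n k s) / real n + real n)
     + (1 - \<alpha>) * sqrt (real_of_int (epsilon0 n k s))"

text \<open>
  \<open>X = Inl ` {..<n}\<close>, \<open>Y = Inr ` {..<a + b}\<close>, \<open>X\<^sub>1 = Inl ` {..<n - k}\<close>,
  \<open>Y\<^sub>1 = Inr ` {..<b}\<close>. The definition is meant for \<open>n > k\<close>, \<open>a \<ge> k + 1\<close> and \<open>b \<ge> 1\<close>.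
\<close>

definition Z_graph :: "nat \<Rightarrow> nat \<Rightarrow> nat \<Rightarrow> nat \<Rightarrow> (nat + nat) pair_pre_digraph" where
  "Z_graph n k a b =
     (let E = {(i, j). i < n \<and> j < a + b \<and> \<not> (i < n - k \<and> j < b)}
      in \<lparr> pverts = Inl ` {..<n} \<union> Inr ` {..<a + b},
           parcs = (\<lambda>(i, j). (Inl i, Inr j)) ` E \<union> (\<lambda>(i, j). (Inr j, Inl i)) ` E \<rparr>)"

definition F_graph :: "nat \<Rightarrow> nat \<Rightarrow> int \<Rightarrow> (nat + nat) pair_pre_digraph" where
  "F_graph n k s = Z_graph n k (nat (int n + s - int k - 1)) (nat (int k + 1 - s))"

lemma vertex_list:
  assumes "pair_graph G"
  shows "distinct (vertex_list G)" "set (vertex_list G) = pverts G"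
proof -
  interpret pair_graph G by fact
  have "\<exists>vs. distinct vs \<and> set vs = pverts G"
    using finite_distinct_list[OF pair_finite_verts] by blast
  from someI_ex[OF this] show "distinct (vertex_list G)" "set (vertex_list G) = pverts G"
    unfolding vertex_list_def by auto
qed

lemma eigenvalue_vertex_indexed:
  assumes "distinct vs"
  shows "eigenvalue (adjacency_matrix G vs + \<alpha> \<cdot>\<^sub>m degree_matrix G vs) l \<longleftrightarrow>
    (\<exists>f. (\<exists>v\<in>set vs. f v \<noteq> 0) \<and>
      (\<forall>u\<in>set vs. (\<Sum>v\<in>set vs. if (u, v) \<in> parcs G then f v else 0)
         + \<alpha> * real (out_degree (with_proj G) u) * f u = l * f u))"
    (is "eigenvalue ?M l \<longleftrightarrow> (\<exists>f. ?P f)")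
proof -
  let ?n = "length vs"
  have dim: "dim_row ?M = ?n" "dim_col ?M = ?n"
    by (auto simp: adjacency_matrix_def degree_matrix_def)
  have ent: "(?M *\<^sub>v x) $ i = (\<Sum>v\<in>set vs. if (vs ! i, v) \<in> parcs G then f v else 0)
         + \<alpha> * real (out_degree (with_proj G) (vs ! i)) * f (vs ! i)"
    if x: "x \<in> carrier_vec ?n" and f: "\<And>j. j < ?n \<Longrightarrow> x $ j = f (vs ! j)" and i: "i < ?n"
    for x f i
  proof -
    have "(?M *\<^sub>v x) $ i = (\<Sum>j<?n. ?M $$ (i, j) * x $ j)"
      using x i dim by (auto simp: scalar_prod_def lessThan_atLeast0)
    also have "\<dots> = (\<Sum>j<?n. (if (vs ! i, vs ! j) \<in> parcs G then f (vs ! j) else 0)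
         + (if i = j then \<alpha> * real (out_degree (with_proj G) (vs ! i)) * f (vs ! i) else 0))"
      using i by (intro sum.cong) (auto simp: adjacency_matrix_def degree_matrix_def f algebra_simps)
    also have "\<dots> = (\<Sum>j<?n. (if (vs ! i, vs ! j) \<in> parcs G then f (vs ! j) else 0))
         + \<alpha> * real (out_degree (with_proj G) (vs ! i)) * f (vs ! i)"
      using i by (simp add: sum.distrib)
    also have "(\<Sum>j<?n. (if (vs ! i, vs ! j) \<in> parcs G then f (vs ! j) else 0))
        = (\<Sum>v\<in>set vs. if (vs ! i, v) \<in> parcs G then f v else 0)"
      by (rule sum.reindex_bij_betw) (rule bij_betw_nth[OF assms], auto)
    finally show ?thesis .
  qed
  show ?thesis
  proof
    assume "eigenvalue ?M l"
    then obtain x where x: "x \<in> carrier_vec ?n" "x \<noteq> 0\<^sub>v ?n" "?M *\<^sub>v x = l \<cdot>\<^sub>v x"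
      unfolding eigenvalue_def eigenvector_def dim by auto
    define f where "f v = x $ (the_inv_into {..<?n} ((!) vs) v)" for v
    have inj: "inj_on ((!) vs) {..<?n}" using assms by (simp add: inj_on_nth)
    have f: "x $ j = f (vs ! j)" if "j < ?n" for j
      using that unfolding f_def by (subst the_inv_into_f_f[OF inj]) auto
    obtain j where "j < ?n" "x $ j \<noteq> 0" using x(1,2) by (metis eq_vecI carrier_vecD index_zero_vec)
    then have "\<exists>v\<in>set vs. f v \<noteq> 0" using f by auto
    moreover have "\<forall>u\<in>set vs. (\<Sum>v\<in>set vs. if (u, v) \<in> parcs G then f v else 0)
         + \<alpha> * real (out_degree (with_proj G) u) * f u = l * f u"
      using ent[OF x(1) f] x(1,3) f by (auto simp: in_set_conv_nth)
    ultimately show "\<exists>f. ?P f" by blast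
  next
    assume "\<exists>f. ?P f"
    then obtain f where f: "?P f" by blast
    define x where "x = vec ?n (\<lambda>j. f (vs ! j))"
    have x: "x \<in> carrier_vec ?n" "\<And>j. j < ?n \<Longrightarrow> x $ j = f (vs ! j)" by (auto simp: x_def)
    have "x \<noteq> 0\<^sub>v ?n" using f x(2) by (metis in_set_conv_nth index_zero_vec(1))
    moreover have "?M *\<^sub>v x = l \<cdot>\<^sub>v x"
      using ent[OF x] f x dim by (intro eq_vecI) auto
    ultimately show "eigenvalue ?M l"
      unfolding eigenvalue_def eigenvector_def dim using x(1) by blast
  qed
qed

end

theory Submission
  imports Defs
begin

text \<open>
  The largest eigenvalue controls the number of edges. On an eigenvector, the form of
  \<open>A + \<alpha> D = \<alpha> (A + D) + (1 - \<alpha>) A\<close> splits into a form with bound \<open>e / n + n\<close> and one with bound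
  \<open>sqrt e\<close>, where \<open>e\<close> is the number of edges (\<open>Theta_le\<close>). Since \<open>\<Theta>\<^sub>0\<close> is this bound at
  \<open>e = \<epsilon>\<^sub>0\<close>, the spectral hypothesis says that fewer than
  \<open>n\<^sup>2 - \<epsilon>\<^sub>0 = (k - q + 1) * (n - k - 1)\<close> edges between the two sides are missing
  (\<open>few_missing_edges\<close>).

  Deleting \<open>q\<close> vertices on each side does not increase the number of missing edges. With \<open>m = n - q\<close>
  vertices left on each side and \<open>t = k - q\<close>, the remaining graph has minimum degree at least \<open>t\<close> and
  fewer than \<open>(t + 1) * (m - t - 1)\<close> missing edges, so the parameters \<open>n\<close>, \<open>k\<close>, \<open>q\<close> enter only through
  \<open>m\<close> and \<open>t\<close>.

  For such a graph, being Hamiltonian fails for only one reason: some \<open>t\<close> vertices on one side have at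
  most \<open>t\<close> neighbours altogether (\<open>tight_set_if_not_hamiltonian\<close>). By the closure lemma
  \<open>hamiltonian_add_edge\<close> one may join nonadjacent vertices of opposite sides whose degrees sum to more
  than \<open>m\<close>, and in a graph that is closed under this operation the few missing edges determine the
  structure (\<open>closed_bigraph_tight_set\<close>).

  Back in \<open>G\<close>, the tight set has at most \<open>t + q = k\<close> neighbours, and this is what it takes to number
  the vertices such that \<open>G\<close> becomes a subgraph of the exceptional graph \<open>F\<close> (\<open>tight_set_embeds\<close>).
\<close>

unbundle no vec_syntax

section \<open>Hamilton cycles of balanced bipartite graphs\<close>

text \<open>
  The arcs of a balanced bipartite graph, without the graph record: the closure argument adds edges
  one at a time, and the vertices are deleted only once, so a bare relation over two fixed sides is
  the handier object.
\<close>

definition balanced_bigraph :: "'a set \<Rightarrow> 'a set \<Rightarrow> 'a rel \<Rightarrow> bool" where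
  "balanced_bigraph U V R \<longleftrightarrow> finite U \<and> finite V \<and> card U = card V \<and> U \<inter> V = {} \<and> sym R
     \<and> R \<subseteq> U \<times> V \<union> V \<times> U"

text \<open>
  A Hamilton cycle as the cyclic list of its vertices. With two vertices this admits the degenerate
  walk along one edge; the number of vertices excludes it where spanning cycles are concerned.
\<close>

definition hamiltonian :: "'a set \<Rightarrow> 'a rel \<Rightarrow> bool" where
  "hamiltonian W R \<longleftrightarrow>
     (\<exists>c. distinct c \<and> set c = W \<and> successively (\<lambda>a b. (a, b) \<in> R) c \<and> (last c, hd c) \<in> R)"

lemma bigraph_swap: "balanced_bigraph U V R \<Longrightarrow> balanced_bigraph V U R"
  unfolding balanced_bigraph_def by auto

lemma bigraph_sym: "balanced_bigraph U V R \<Longrightarrow> (a, b) \<in> R \<Longrightarrow> (b, a) \<in> R"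
  unfolding balanced_bigraph_def sym_def by auto

lemma bigraph_nbrs:
  assumes "balanced_bigraph U V R" "u \<in> U"
  shows "R `` {u} \<subseteq> V" "finite (R `` {u})"
proof -
  show "R `` {u} \<subseteq> V" using assms unfolding balanced_bigraph_def by auto
  then show "finite (R `` {u})" using assms unfolding balanced_bigraph_def by (metis finite_subset)
qed

text \<open>
  Ore's crossing argument. On a Hamilton path from \<open>x\<close> to \<open>y\<close> call a position \<open>i\<close> good for \<open>x\<close>
  if \<open>x\<close> is adjacent to the vertex after it, and good for \<open>y\<close> if \<open>y\<close> is adjacent to the vertex at
  it. In a bipartite graph both kinds of positions carry a vertex of \<open>U\<close>, so there are at most
  \<open>card U\<close> of them altogether, which is less than the sum of the two degrees: some position is good
  for both. Reversing the path behind that position gives a cycle.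
\<close>

lemma hamiltonian_path_closes:
  assumes G: "balanced_bigraph U V R" and x: "x \<in> U" and y: "y \<in> V"
    and deg: "card U < card (R `` {x}) + card (R `` {y})"
    and p: "distinct p" "set p = U \<union> V" "successively (\<lambda>a b. (a, b) \<in> R) p"
      "hd p = x" "last p = y"
  shows "hamiltonian (U \<union> V) R"
proof -
  have ne: "p \<noteq> []" using p(2) x by auto
  have fin: "finite U" "finite V" and dis: "U \<inter> V = {}" using G unfolding balanced_bigraph_def by auto
  have irr: "(z, z) \<notin> R" for z using G unfolding balanced_bigraph_def by auto
  define S where "S = {i. Suc i < length p \<and> (x, p ! Suc i) \<in> R}"
  define T where "T = {i. Suc i < length p \<and> (p ! i, y) \<in> R}"
  have finST: "finite S" "finite T"
    unfolding S_def T_def by (auto intro: finite_subset[of _ "{..<length p}"])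
  have p0: "p ! 0 = x" using p ne by (simp add: hd_conv_nth)
  have pl: "p ! (length p - 1) = y" using p ne by (simp add: last_conv_nth)
  have Rset: "a \<in> set p" "b \<in> set p" if "(a, b) \<in> R" for a b
    using that G p(2) unfolding balanced_bigraph_def by auto
  have "R `` {x} \<subseteq> (\<lambda>i. p ! Suc i) ` S"
  proof
    fix z assume z: "z \<in> R `` {x}"
    then obtain j where j: "j < length p" "p ! j = z" using Rset by (metis Image_singleton_iff in_set_conv_nth)
    have "j \<noteq> 0" using z j(2) p0 irr by (metis Image_singleton_iff)
    then obtain i where "j = Suc i" by (cases j) auto
    then show "z \<in> (\<lambda>i. p ! Suc i) ` S" using z j unfolding S_def by auto
  qed
  then have 1: "card (R `` {x}) \<le> card S" using finST by (meson surj_card_le)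
  have "R `` {y} \<subseteq> (\<lambda>i. p ! i) ` T"
  proof
    fix z assume z: "z \<in> R `` {y}"
    then obtain j where j: "j < length p" "p ! j = z" using Rset by (metis Image_singleton_iff in_set_conv_nth)
    have "j \<noteq> length p - 1" using z j(2) pl irr by (metis Image_singleton_iff)
    then show "z \<in> (\<lambda>i. p ! i) ` T" using z j bigraph_sym[OF G] unfolding T_def by auto
  qed
  then have 2: "card (R `` {y}) \<le> card T" using finST by (meson surj_card_le)
  have step: "(p ! i, p ! Suc i) \<in> R" if "Suc i < length p" for i
    using p(3) that by (simp add: successively_conv_nth)
  have "(\<lambda>i. p ! i) ` (S \<union> T) \<subseteq> U"
  proof -
    have "p ! i \<in> U" if "i \<in> S" for i
    proof -
      have "p ! Suc i \<in> V" using that x G dis unfolding S_def balanced_bigraph_def by auto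
      moreover have "(p ! i, p ! Suc i) \<in> R" using that step unfolding S_def by auto
      ultimately show ?thesis using G dis unfolding balanced_bigraph_def by auto
    qed
    moreover have "p ! i \<in> U" if "i \<in> T" for i
      using that y G dis unfolding T_def balanced_bigraph_def by auto
    ultimately show ?thesis by auto
  qed
  moreover have "inj_on (\<lambda>i. p ! i) (S \<union> T)"
    using p(1) unfolding S_def T_def by (intro inj_on_nth) auto
  ultimately have "card (S \<union> T) \<le> card U" using fin by (meson card_inj_on_le)
  then have "card (S \<inter> T) \<noteq> 0" using 1 2 deg card_Un_Int[OF finST] by linarith
  then obtain i where i: "Suc i < length p" "(x, p ! Suc i) \<in> R" "(p ! i, y) \<in> R"
    unfolding S_def T_def by (metis (mono_tags, lifting) IntE card.empty ex_in_conv mem_Collect_eq)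
  define as bs where "as = take (Suc i) p" and "bs = drop (Suc i) p"
  have pe: "p = as @ bs" and nas: "as \<noteq> []" and nbs: "bs \<noteq> []"
    using i unfolding as_def bs_def by auto
  have e: "last as = p ! i" "hd bs = p ! Suc i" "hd as = x" "last bs = y"
    using i p ne unfolding as_def bs_def
    by (auto simp: hd_drop_conv_nth take_Suc_conv_app_nth hd_append hd_conv_nth)
  have *: "successively (\<lambda>a b. (a, b) \<in> R) as" "successively (\<lambda>a b. (a, b) \<in> R) bs"
    using p(3) unfolding pe by (auto simp: successively_append_iff)
  have "successively (\<lambda>a b. (b, a) \<in> R) bs"
    using *(2) by (rule successively_mono) (use bigraph_sym[OF G] in auto)
  then have "successively (\<lambda>a b. (a, b) \<in> R) (as @ rev bs)"
    using * e i nas nbs by (auto simp: successively_append_iff hd_rev)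
  moreover have "(last (as @ rev bs), hd (as @ rev bs)) \<in> R"
    using e i nas nbs bigraph_sym[OF G] by (auto simp: last_rev)
  moreover have "distinct (as @ rev bs)" "set (as @ rev bs) = U \<union> V"
    using p(1,2) unfolding pe by auto
  ultimately show ?thesis unfolding hamiltonian_def by blast
qed

lemma rotate_closed_walk:
  assumes "successively P (as @ bs)" "P (last (as @ bs)) (hd (as @ bs))" "bs \<noteq> []"
  shows "successively P (bs @ as)" "P (last (bs @ as)) (hd (bs @ as))"
  using assms by (cases "as = []"; simp add: successively_append_iff)+

text \<open>
  The bipartite form of the Bondy-Chvatal closure. If the Hamilton cycle uses the new edge,
  removing that edge leaves a Hamilton path between \<open>x\<close> and \<open>y\<close>, and the path closes up in \<open>R\<close>.
\<close>

lemma hamiltonian_add_edge: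
  assumes G: "balanced_bigraph U V R" and m: "2 \<le> card U" and x: "x \<in> U" and y: "y \<in> V"
    and deg: "card U < card (R `` {x}) + card (R `` {y})"
    and ham: "hamiltonian (U \<union> V) (R \<union> {(x, y), (y, x)})"
  shows "hamiltonian (U \<union> V) R"
proof -
  let ?R = "R \<union> {(x, y), (y, x)}"
  have fin: "finite U" "finite V" and dis: "U \<inter> V = {}" and cUV: "card U = card V"
    using G unfolding balanced_bigraph_def by auto
  have xy: "x \<noteq> y" using x y dis by auto
  obtain c where c: "distinct c" "set c = U \<union> V" "successively (\<lambda>a b. (a, b) \<in> ?R) c"
      "(last c, hd c) \<in> ?R"
    using ham unfolding hamiltonian_def by blast
  \<comment> \<open>Start the cycle at \<open>x\<close>: then \<open>xy\<close> can only be its first or its last edge.\<close>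
  obtain as bs where cs: "c = as @ x # bs" using x c(2) by (metis UnI1 split_list)
  define t where "t = bs @ as"
  have d: "distinct (x # t)" and s: "set (x # t) = U \<union> V"
    using c(1,2) unfolding cs t_def by auto
  have suc: "successively (\<lambda>a b. (a, b) \<in> ?R) (x # t)" and l: "(last (x # t), x) \<in> ?R"
    using rotate_closed_walk[of "\<lambda>a b. (a, b) \<in> ?R" as "x # bs"] c(3,4) unfolding cs t_def by simp_all
  have len: "length t \<ge> 3"
  proof -
    have "card (U \<union> V) = 2 * card U" using fin dis cUV by (simp add: card_Un_disjoint)
    then have "Suc (length t) = 2 * card U" using distinct_card[OF d] s by simp
    then show ?thesis using m by linarith
  qed
  have tR: "successively (\<lambda>a b. (a, b) \<in> R) t"
  proof -
    have "successively (\<lambda>a b. (a, b) \<in> ?R) t" using suc by (cases t) auto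
    then show ?thesis by (rule successively_mono) (use d in auto)
  qed
  have tne: "t \<noteq> []" using len by auto
  have lht: "last t \<noteq> hd t" using d len by (cases t) (auto split: if_splits)
  have hdR: "(x, hd t) \<in> ?R" using suc tne by (auto simp: successively_Cons)
  have laR: "(last t, x) \<in> ?R" using l tne by auto
  have path: "hamiltonian (U \<union> V) R"
    if "successively (\<lambda>a b. (a, b) \<in> R) r" "set r = set t" "distinct r" "r \<noteq> []" "(x, hd r) \<in> R"
      "last r = y" for r
    by (rule hamiltonian_path_closes[OF G x y deg, of "x # r"])
       (use that d s in \<open>auto simp: successively_Cons\<close>)
  consider "last t = y" | "hd t = y" | "last t \<noteq> y" "hd t \<noteq> y" by blast
  then show ?thesis
  proof cases
    case 1
    then show ?thesis using tR d tne hdR lht xy by (intro path[of t]) auto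
  next
    case 2
    have "successively (\<lambda>a b. (b, a) \<in> R) t"
      using tR by (rule successively_mono) (use bigraph_sym[OF G] in auto)
    moreover have "(x, last t) \<in> R" using laR 2 lht xy bigraph_sym[OF G] by auto
    ultimately show ?thesis using d tne 2 by (intro path[of "rev t"]) (auto simp: hd_rev last_rev)
  next
    case 3
    then have "(x, hd t) \<in> R" "(last t, x) \<in> R" using hdR laR xy by auto
    then show ?thesis unfolding hamiltonian_def using tR d s tne
      by (intro exI[of _ "x # t"]) (auto simp: successively_Cons)
  qed
qed

lemma splice_alternates:
  assumes "length us = length vs" "us \<noteq> []" "set us \<times> set vs \<union> set vs \<times> set us \<subseteq> R"
  shows "successively (\<lambda>a b. (a, b) \<in> R) (splice us vs) \<and> hd (splice us vs) = hd us
    \<and> last (splice us vs) = last vs \<and> set (splice us vs) = set us \<union> set vs"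
  using assms
proof (induction us vs rule: list_induct2)
  case (Cons u us v vs)
  show ?case
  proof (cases "us = []")
    case True
    then show ?thesis using Cons by auto
  next
    case False
    then have IH: "successively (\<lambda>a b. (a, b) \<in> R) (splice us vs)" "hd (splice us vs) = hd us"
        "last (splice us vs) = last vs" "set (splice us vs) = set us \<union> set vs"
      using Cons by auto
    have "vs \<noteq> []" "splice us vs \<noteq> []" using False Cons.hyps by (cases us; cases vs; auto)+
    moreover have "(u, v) \<in> R" "(v, hd us) \<in> R" using Cons.prems(2) hd_in_set[OF False] by auto
    ultimately show ?thesis using IH False by (auto simp: successively_Cons)
  qed
qed auto

lemma complete_bigraph_hamiltonian:
  assumes G: "balanced_bigraph U V R" and ne: "U \<noteq> {}" and full: "U \<times> V \<subseteq> R"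
  shows "hamiltonian (U \<union> V) R"
proof -
  have fin: "finite U" "finite V" and dis: "U \<inter> V = {}" and cUV: "card U = card V"
    using G unfolding balanced_bigraph_def by auto
  obtain us vs where us: "set us = U" "distinct us" and vs: "set vs = V" "distinct vs"
    using finite_distinct_list fin by metis
  have len: "length us = length vs" using us vs cUV by (metis distinct_card)
  have "us \<noteq> []" "vs \<noteq> []" using us(1) ne len by auto
  have R: "set us \<times> set vs \<union> set vs \<times> set us \<subseteq> R"
    using full bigraph_sym[OF G] us vs by auto
  note sp = splice_alternates[OF len \<open>us \<noteq> []\<close> R]
  have setsp: "set (splice us vs) = U \<union> V" using sp us vs by auto
  have "card (U \<union> V) = length (splice us vs)"
    using us vs fin dis by (simp add: card_Un_disjoint distinct_card[symmetric])
  then have "distinct (splice us vs)" using setsp by (intro card_distinct) simp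
  moreover have "(last (splice us vs), hd (splice us vs)) \<in> R"
    using sp R last_in_set[OF \<open>vs \<noteq> []\<close>] hd_in_set[OF \<open>us \<noteq> []\<close>] by auto
  ultimately show ?thesis unfolding hamiltonian_def using sp setsp by blast
qed

section \<open>Non-Hamiltonian graphs with few missing edges\<close>

text \<open>
  The nonadjacent pair \<open>x\<close>, \<open>y\<close> is chosen extremal. With \<open>j\<close> the degree of \<open>x\<close>, the vertex \<open>y\<close>
  has at least \<open>j\<close> non-neighbours, all of degree at most \<open>j\<close>. Any \<open>j\<close> of them, collected in \<open>A\<close>,
  account for \<open>j * (card U - j)\<close> missing edges. As \<open>j\<close> is at most \<open>card U / 2\<close>, the bound on the
  number of missing edges leaves only \<open>j = t\<close>, and then fewer than \<open>card U - t\<close> edges outside of \<open>A\<close>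
  are missing.

  This forces every neighbour \<open>w\<close> of \<open>A\<close> to be adjacent to all of \<open>U\<close>. A non-neighbour \<open>u\<close> of
  \<open>w\<close> outside of \<open>A\<close> has, by closedness, degrees with \<open>d u + d w \<le> card U\<close>, so that \<open>u\<close> and \<open>w\<close>
  together miss at least \<open>card U - t\<close> edges outside of \<open>A\<close>. Hence \<open>w\<close> is adjacent to all of
  \<open>U - A\<close>, its degree exceeds \<open>card U - t\<close>, and closedness makes it adjacent to \<open>A\<close> as well. So all
  members of \<open>A\<close> have the same at most \<open>t\<close> neighbours.
\<close>

lemma closed_bigraph_tight_set:
  fixes t :: nat
  assumes G: "balanced_bigraph U V R"
    and closed: "\<And>u v. u \<in> U \<Longrightarrow> v \<in> V \<Longrightarrow> (u, v) \<notin> R \<Longrightarrow> card (R `` {u}) + card (R `` {v}) \<le> card U"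
    and mindeg: "\<And>u. u \<in> U \<Longrightarrow> t \<le> card (R `` {u})"
    and missing: "card (U \<times> V - R) < (t + 1) * (card U - t - 1)"
    and x: "x \<in> U" and y: "y \<in> V" and xy: "(x, y) \<notin> R"
    and le: "card (R `` {x}) \<le> card (R `` {y})"
    and maximal: "\<And>u. u \<in> U \<Longrightarrow> (u, y) \<notin> R \<Longrightarrow> card (R `` {u}) \<le> card (R `` {x})"
  shows "\<exists>A B. A \<subseteq> U \<and> B \<subseteq> V \<and> card A = t \<and> card B \<le> t \<and> R `` A \<subseteq> B"
proof -
  have fin: "finite U" "finite V" and dis: "U \<inter> V = {}" and cUV: "card V = card U"
    using G unfolding balanced_bigraph_def by auto
  define m where "m = card U"
  define d where "d z = card (R `` {z})" for z
  define j where "j = d x"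
  have finM: "finite (U \<times> V - R)" using fin by auto
  have nonnbrs: "card (V - R `` {u}) = m - d u" if "u \<in> U" for u
    using bigraph_nbrs[OF G that] fin cUV unfolding m_def d_def by (simp add: card_Diff_subset)
  have sub: "R `` {y} \<subseteq> U" "finite (R `` {y})"
    using bigraph_nbrs[OF bigraph_swap[OF G] y] by auto
  have xyle: "j + d y \<le> m" using closed[OF x y xy] unfolding j_def d_def m_def .
  have "card (U - R `` {y}) = m - d y"
    using sub fin by (simp add: card_Diff_subset m_def d_def)
  then have "j \<le> card (U - R `` {y})" using xyle by linarith
  then obtain A where A: "A \<subseteq> U - R `` {y}" "card A = j" "finite A"
    by (rule obtain_subset_with_card_n)
  have AU: "A \<subseteq> U" using A by auto
  have Ad: "d a \<le> j" if "a \<in> A" for a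
    using maximal[of a] A(1) that bigraph_sym[OF G, of a y] unfolding j_def d_def by auto
  let ?P = "SIGMA a:A. V - R `` {a}"
  have cP: "j * (m - j) \<le> card ?P"
  proof -
    have "card ?P = (\<Sum>a\<in>A. card (V - R `` {a}))" using A fin by (intro card_SigmaI) auto
    also have "\<dots> = (\<Sum>a\<in>A. m - d a)" using AU nonnbrs by (intro sum.cong) auto
    also have "\<dots> \<ge> (\<Sum>a\<in>A. m - j)" using Ad by (intro sum_mono) (simp add: diff_le_mono2)
    finally show ?thesis using A(2) by simp
  qed
  have "card ?P \<le> card (U \<times> V - R)" using finM AU by (intro card_mono) auto
  have missing': "card (U \<times> V - R) < (t + 1) * (m - (t + 1))" using missing unfolding m_def by simp
  with cP \<open>card ?P \<le> card (U \<times> V - R)\<close> have lt: "j * (m - j) < (t + 1) * (m - (t + 1))" by linarith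
  have "t \<le> j" using mindeg[OF x] unfolding j_def d_def .
  have "2 * j \<le> m" using xyle le unfolding j_def d_def by simp
  \<comment> \<open>\<open>j * (m - j)\<close> increases with \<open>j\<close> up to \<open>m / 2\<close>.\<close>
  have "j = t"
  proof (rule ccontr)
    assume "j \<noteq> t"
    then obtain r where r: "j = t + 1 + r" using \<open>t \<le> j\<close> by (metis Suc_eq_plus1 Suc_leI le_Suc_ex le_neq_implies_less)
    obtain w where w: "m = 2 * j + w" using \<open>2 * j \<le> m\<close> le_Suc_ex by blast
    show False using lt unfolding w r by (simp add: algebra_simps)
  qed
  have full: "(u, w) \<in> R" if a: "a \<in> A" "(a, w) \<in> R" and u: "u \<in> U - A" for a u w
  proof (rule ccontr)
    assume n: "(u, w) \<notin> R"
    have w: "w \<in> V" using a AU G dis unfolding balanced_bigraph_def by auto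
    have uw: "d u + d w \<le> m" using closed[OF _ w n] u unfolding d_def m_def by auto
    have sw: "R `` {w} \<subseteq> U" "finite (R `` {w})"
      using bigraph_nbrs[OF bigraph_swap[OF G] w] by auto
    \<comment> \<open>The missing edges at \<open>A\<close>, at \<open>u\<close>, and at \<open>w\<close> outside of \<open>A\<close> and \<open>u\<close> are pairwise distinct;\<close>
    \<comment> \<open>among the neighbours of \<open>w\<close> the vertex \<open>a\<close> lies in \<open>A\<close> and does not reduce the last number.\<close>
    let ?Q = "{u} \<times> (V - R `` {u})" and ?W = "U - A - {u}"
    let ?S = "(?W - (R `` {w} - {a})) \<times> {w}"
    have cQ: "card ?Q = m - d u" using nonnbrs u by (simp add: card_cartesian_product)
    have "card ?W = m - t - 1"
      using u A AU fin \<open>j = t\<close> by (simp add: card_Diff_subset m_def)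
    moreover have "card (R `` {w} - {a}) = d w - 1"
      using sw bigraph_sym[OF G a(2)] by (simp add: d_def)
    moreover have "card ?W - card (R `` {w} - {a}) \<le> card (?W - (R `` {w} - {a}))"
      using sw by (intro diff_card_le_card_Diff) auto
    ultimately have cS: "m - t - 1 - (d w - 1) \<le> card ?S" by (simp add: card_cartesian_product)
    have dw: "d w \<noteq> 0" using sw bigraph_sym[OF G a(2)] unfolding d_def by auto
    have "?S \<subseteq> U \<times> V - R" using bigraph_sym[OF G] a u w by auto
    moreover have "?P \<subseteq> U \<times> V - R" "?Q \<subseteq> U \<times> V - R" using AU u by auto
    ultimately have "card (?P \<union> ?Q \<union> ?S) \<le> card (U \<times> V - R)" using finM by (intro card_mono) auto
    moreover have "card (?P \<union> ?Q \<union> ?S) = card ?P + card ?Q + card ?S"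
    proof -
      have "finite ?P" "finite ?Q" "finite ?S" using A fin by auto
      moreover have "(?P \<union> ?Q) \<inter> ?S = {}" "?P \<inter> ?Q = {}" using u by auto
      ultimately show ?thesis by (simp only: card_Un_disjoint finite_UnI)
    qed
    ultimately have "card ?P + card ?Q + card ?S \<le> card (U \<times> V - R)" by simp
    moreover have "t * (m - t) \<le> card ?P" using cP \<open>j = t\<close> by simp
    ultimately have "t * (m - t) + (m - d u) + (m - t - 1 - (d w - 1)) < (t + 1) * (m - (t + 1))"
      using cQ cS missing' by linarith
    moreover have "m - t \<le> (m - d u) + (m - t - 1 - (d w - 1))" using uw dw by linarith
    moreover have "(t + 1) * (m - (t + 1)) \<le> (t + 1) * (m - t)" by (intro mult_left_mono) auto
    moreover have "(t + 1) * (m - t) = t * (m - t) + (m - t)" by (simp only: add_mult_distrib mult_1)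
    ultimately show False by linarith
  qed
  have all: "(b, w) \<in> R" if a: "a \<in> A" "(a, w) \<in> R" and b: "b \<in> A" for a b w
  proof (rule ccontr)
    assume n: "(b, w) \<notin> R"
    have w: "w \<in> V" using a AU G dis unfolding balanced_bigraph_def by auto
    have sw: "R `` {w} \<subseteq> U" "finite (R `` {w})"
      using bigraph_nbrs[OF bigraph_swap[OF G] w] by auto
    have "insert a (U - A) \<subseteq> R `` {w}" using full[OF a] a bigraph_sym[OF G] by auto
    then have "card (insert a (U - A)) \<le> d w" unfolding d_def by (rule card_mono[OF sw(2)])
    moreover have "card (insert a (U - A)) = Suc (m - t)"
      using a A AU fin \<open>j = t\<close> by (simp add: card_Diff_subset m_def)
    ultimately have "m - t < d w" by simp
    moreover have "t \<le> d b" using mindeg b AU unfolding d_def by auto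
    moreover have "d b + d w \<le> m" using closed[OF _ w n] b AU unfolding d_def m_def by auto
    ultimately show False by linarith
  qed
  have "card (R `` A) \<le> t"
  proof (cases "R `` A = {}")
    case False
    then obtain b where b: "b \<in> A" by auto
    have "R `` A \<subseteq> R `` {b}" using all b by auto
    then have "card (R `` A) \<le> d b"
      unfolding d_def using bigraph_nbrs[OF G] b AU by (intro card_mono) auto
    then show ?thesis using Ad[OF b] \<open>j = t\<close> by simp
  qed simp
  moreover have "R `` A \<subseteq> V" using bigraph_nbrs(1)[OF G] AU by fast
  ultimately show ?thesis using A AU \<open>j = t\<close> by blast
qed

text \<open>
  Adding edges between nonadjacent vertices of large degree sum keeps the graph non-Hamiltonian and
  its hypotheses true, and a set that is tight afterwards was tight before. So the graph may be taken
  closed, where a nonadjacent pair of maximal degree sum is extremal on the side of its vertex of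
  smaller degree; that vertex decides on which side the tight set lies.
\<close>

lemma tight_set_if_not_hamiltonian:
  fixes t :: nat
  assumes "balanced_bigraph U V R" and "2 \<le> card U"
    and "\<And>z. z \<in> U \<union> V \<Longrightarrow> t \<le> card (R `` {z})"
    and "card (U \<times> V - R) < (t + 1) * (card U - t - 1)"
    and "\<not> hamiltonian (U \<union> V) R"
  shows "\<exists>A B. (A \<subseteq> U \<and> B \<subseteq> V \<or> A \<subseteq> V \<and> B \<subseteq> U) \<and> card A = t \<and> card B \<le> t \<and> R `` A \<subseteq> B"
  using assms
proof (induction "card (U \<times> V - R)" arbitrary: R rule: less_induct)
  case (less R)
  note G = less.prems(1)
  have fin: "finite U" "finite V" and dis: "U \<inter> V = {}" and cUV: "card U = card V"
    using G unfolding balanced_bigraph_def by auto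
  define d where "d z = card (R `` {z})" for z
  define N where "N = U \<times> V - R"
  have finN: "finite N" using fin unfolding N_def by auto
  show ?case
  proof (cases "\<exists>x\<in>U. \<exists>y\<in>V. (x, y) \<notin> R \<and> card U < d x + d y")
    case True
    then obtain x y where xy: "x \<in> U" "y \<in> V" "(x, y) \<notin> R" "card U < d x + d y"
      by blast
    let ?R = "R \<union> {(x, y), (y, x)}"
    have G': "balanced_bigraph U V ?R" using G xy unfolding balanced_bigraph_def sym_def by auto
    have less_missing: "card (U \<times> V - ?R) < card (U \<times> V - R)"
      using fin xy by (intro psubset_card_mono) auto
    have "t \<le> card (?R `` {z})" if "z \<in> U \<union> V" for z
    proof -
      have "finite (?R `` {z})"
        using bigraph_nbrs(2)[OF G'] bigraph_nbrs(2)[OF bigraph_swap[OF G']] that by auto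
      then have "card (R `` {z}) \<le> card (?R `` {z})" by (intro card_mono) auto
      then show ?thesis using less.prems(3)[OF that] by linarith
    qed
    moreover have "\<not> hamiltonian (U \<union> V) ?R"
      using hamiltonian_add_edge[OF G less.prems(2) xy(1,2)] xy(4) less.prems(5)
      unfolding d_def by blast
    moreover have "card (U \<times> V - ?R) < (t + 1) * (card U - t - 1)"
      using less_missing less.prems(4) by linarith
    ultimately have "\<exists>A B. (A \<subseteq> U \<and> B \<subseteq> V \<or> A \<subseteq> V \<and> B \<subseteq> U) \<and> card A = t \<and> card B \<le> t
        \<and> ?R `` A \<subseteq> B"
      by (intro less.hyps[OF less_missing G' less.prems(2)])
    then obtain A B where AB: "A \<subseteq> U \<and> B \<subseteq> V \<or> A \<subseteq> V \<and> B \<subseteq> U" "card A = t" "card B \<le> t"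
        "?R `` A \<subseteq> B"
      by (elim exE conjE)
    have "R `` A \<subseteq> ?R `` A" by (rule Image_mono) auto
    with AB(4) have "R `` A \<subseteq> B" by (rule order_trans[rotated])
    with AB(1-3) show ?thesis by (intro exI[of _ A] exI[of _ B] conjI)
  next
    case False
    then have closed: "d x + d y \<le> card U" if "x \<in> U" "y \<in> V" "(x, y) \<notin> R" for x y
      using that by (meson leI)
    have "U \<noteq> {}" using less.prems(2) by auto
    then have "N \<noteq> {}" using complete_bigraph_hamiltonian[OF G] less.prems(5) unfolding N_def by blast
    define f where "f e = d (fst e) + d (snd e)" for e
    have "Max (f ` N) \<in> f ` N" using finN \<open>N \<noteq> {}\<close> by (intro Max_in) auto
    then obtain e where "e \<in> N" "Max (f ` N) = f e" by blast
    then have e: "e \<in> N" "\<And>e'. e' \<in> N \<Longrightarrow> f e' \<le> f e"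
      using finN by (auto simp flip: \<open>Max (f ` N) = f e\<close>)
    obtain x y where exy: "e = (x, y)" by force
    have x: "x \<in> U" and y: "y \<in> V" and n: "(x, y) \<notin> R" using e exy unfolding N_def by auto
    have mx: "d u + d v \<le> d x + d y" if "u \<in> U" "v \<in> V" "(u, v) \<notin> R" for u v
      using e(2)[of "(u, v)"] that unfolding f_def exy N_def by auto
    show ?thesis
    proof (cases "d x \<le> d y")
      case True
      have "\<exists>A B. A \<subseteq> U \<and> B \<subseteq> V \<and> card A = t \<and> card B \<le> t \<and> R `` A \<subseteq> B"
      proof (rule closed_bigraph_tight_set[OF G])
        show "x \<in> U" "y \<in> V" "(x, y) \<notin> R" by fact+
        show "card (R `` {u}) + card (R `` {v}) \<le> card U" if "u \<in> U" "v \<in> V" "(u, v) \<notin> R" for u v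
          using closed[OF that] unfolding d_def .
        show "card (R `` {u}) \<le> card (R `` {x})" if "u \<in> U" "(u, y) \<notin> R" for u
          using mx[OF that(1) y that(2)] unfolding d_def by simp
      qed (use True less.prems in \<open>auto simp: d_def\<close>)
      then show ?thesis by blast
    next
      case False
      have "\<exists>A B. A \<subseteq> V \<and> B \<subseteq> U \<and> card A = t \<and> card B \<le> t \<and> R `` A \<subseteq> B"
      proof (rule closed_bigraph_tight_set[OF bigraph_swap[OF G]])
        show "y \<in> V" "x \<in> U" by fact+
        show "(y, x) \<notin> R" using n bigraph_sym[OF G] by blast
        show "card (R `` {v}) + card (R `` {u}) \<le> card V" if "v \<in> V" "u \<in> U" "(v, u) \<notin> R" for u v
        proof -
          have "(u, v) \<notin> R" using that bigraph_sym[OF G] by blast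
          from closed[OF that(2,1) this] show ?thesis unfolding d_def cUV by simp
        qed
        show "card (R `` {v}) \<le> card (R `` {y})" if "v \<in> V" "(v, x) \<notin> R" for v
        proof -
          have "(x, v) \<notin> R" using that bigraph_sym[OF G] by blast
          from mx[OF x that(1) this] show ?thesis unfolding d_def by simp
        qed
        have "V \<times> U - R = (U \<times> V - R)\<inverse>" using bigraph_sym[OF G] by auto
        then have "card (V \<times> U - R) = card (U \<times> V - R)" by simp
        then show "card (V \<times> U - R) < (t + 1) * (card V - t - 1)" using less.prems(4) cUV by simp
      qed (use False less.prems in \<open>auto simp: d_def\<close>)
      then show ?thesis by blast
    qed
  qed
qed

section \<open>A bound on the largest eigenvalue\<close>

text \<open>
  A complex eigenvalue \<open>k\<close> exists, and the form of a symmetric real matrix takes real values on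
  complex vectors, so \<open>k\<close> is real and a root of the real characteristic polynomial. The largest
  eigenvalue is defined as the maximum of the real spectrum and is meaningful only because of this.
\<close>

lemma symmetric_real_mat_has_eigenvalue:
  fixes A :: "real mat"
  assumes A: "A \<in> carrier_mat n n" and n: "0 < n"
    and sym: "\<And>i j. i < n \<Longrightarrow> j < n \<Longrightarrow> A $$ (i, j) = A $$ (j, i)"
  shows "spectrum A \<noteq> {}"
proof -
  let ?C = "map_mat complex_of_real A"
  have C: "?C \<in> carrier_mat n n" using A by simp
  obtain k where k: "eigenvalue ?C k"
    using spectrum_non_empty[OF C n] unfolding spectrum_def by auto
  obtain v where v: "v \<in> carrier_vec n" "v \<noteq> 0\<^sub>v n" "?C *\<^sub>v v = k \<cdot>\<^sub>v v"
    using k C A unfolding eigenvalue_def eigenvector_def by auto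
  have row: "(\<Sum>j<n. of_real (A $$ (i, j)) * v $ j) = k * v $ i" if "i < n" for i
  proof -
    have "(?C *\<^sub>v v) $ i = (\<Sum>j<n. of_real (A $$ (i, j)) * v $ j)"
      using that A v(1) by (auto simp: scalar_prod_def lessThan_atLeast0)
    then show ?thesis using v that by simp
  qed
  define z where "z = (\<Sum>i<n. \<Sum>j<n. cnj (v $ i) * of_real (A $$ (i, j)) * v $ j)"
  define N where "N = (\<Sum>i<n. (cmod (v $ i))\<^sup>2)"
  have "z = (\<Sum>i<n. cnj (v $ i) * (\<Sum>j<n. of_real (A $$ (i, j)) * v $ j))"
    unfolding z_def by (simp add: sum_distrib_left mult.assoc)
  also have "\<dots> = (\<Sum>i<n. k * (v $ i * cnj (v $ i)))"
    using row by (intro sum.cong) (simp_all add: ac_simps)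
  also have "\<dots> = k * of_real N"
    unfolding N_def by (simp add: sum_distrib_left flip: complex_norm_square)
  finally have zN: "z = k * of_real N" .
  have "cnj z = (\<Sum>i<n. \<Sum>j<n. v $ i * of_real (A $$ (i, j)) * cnj (v $ j))"
    unfolding z_def by simp
  also have "\<dots> = (\<Sum>j<n. \<Sum>i<n. v $ i * of_real (A $$ (i, j)) * cnj (v $ j))"
    by (rule sum.swap)
  also have "\<dots> = z"
    unfolding z_def using sym by (intro sum.cong) (simp_all add: ac_simps)
  finally have zr: "cnj z = z" .
  obtain i where i: "i < n" "v $ i \<noteq> 0" using v(1,2) by (metis eq_vecI carrier_vecD index_zero_vec)
  have "0 < (cmod (v $ i))\<^sup>2" using i by simp
  also have "\<dots> \<le> N" unfolding N_def using i by (intro member_le_sum) auto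
  finally have "N \<noteq> 0" by simp
  then have "cnj k = k" using zr unfolding zN by simp
  then obtain r where r: "k = of_real r" by (metis Reals_cases Reals_cnj_iff)
  have "poly (char_poly ?C) k = 0" using k eigenvalue_root_char_poly[OF C] by simp
  then have "poly (char_poly A) r = 0"
    unfolding r of_real_hom.char_poly_hom[OF A] of_real_hom.poly_map_poly by simp
  then show ?thesis unfolding spectrum_root_char_poly[OF A] by blast
qed

lemma card_edges_swap:
  assumes "balanced_bigraph U V R"
  shows "card (R \<inter> V \<times> U) = card (R \<inter> U \<times> V)"
proof -
  have "R \<inter> V \<times> U = (R \<inter> U \<times> V)\<inverse>" using bigraph_sym[OF assms] by auto
  then show ?thesis by simp
qed

lemma sum_degrees:
  assumes G: "balanced_bigraph U V R"
  shows "(\<Sum>u\<in>U. card (R `` {u})) = card (R \<inter> U \<times> V)"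
proof -
  have "R \<inter> U \<times> V = (SIGMA u:U. R `` {u})" using G unfolding balanced_bigraph_def by auto
  then show ?thesis
    using G bigraph_nbrs(2)[OF G] unfolding balanced_bigraph_def by (simp add: card_SigmaI)
qed

text \<open>
  The classical quantity degree plus average degree of the neighbours. With \<open>D\<close> the degree of \<open>a\<close>,
  the degrees of the neighbours of \<open>a\<close> sum to at most \<open>e\<close>, as these vertices lie on one side, and
  to at most \<open>D * m\<close>. The second bound settles \<open>D \<le> e / m\<close>; the first one settles the range from
  \<open>e / m\<close> to \<open>m\<close>, on which the convex function \<open>D + e / D\<close> is largest at the two ends. For an
  isolated vertex the sum is empty.
\<close>

lemma signless_row_bound:
  fixes m :: nat
  assumes G: "balanced_bigraph U V R" and a: "a \<in> U" and m: "m = card U"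
  defines "e \<equiv> real (card (R \<inter> U \<times> V))" and "d \<equiv> \<lambda>z. real (card (R `` {z}))"
  shows "(\<Sum>b\<in>R `` {a}. 1 + d b / d a) \<le> e / real m + real m"
proof -
  have fin: "finite U" "finite V" and cUV: "card V = card U" using G unfolding balanced_bigraph_def by auto
  have m0: "0 < m" using a fin unfolding m by (auto simp: card_gt_0_iff)
  have sub: "R `` {a} \<subseteq> V" "finite (R `` {a})" using bigraph_nbrs[OF G a] by auto
  have e0: "0 \<le> e" unfolding e_def by simp
  have dm: "d b \<le> m" if "b \<in> V" for b
    using bigraph_nbrs(1)[OF bigraph_swap[OF G] that] fin unfolding d_def m by (simp add: card_mono)
  have da: "d a \<le> m" using sub fin cUV unfolding d_def m by (metis card_mono of_nat_mono)
  define T where "T = (\<Sum>b\<in>R `` {a}. d b)"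
  have "T \<le> (\<Sum>b\<in>V. d b)" unfolding T_def using sub fin by (intro sum_mono2) (auto simp: d_def)
  also have "\<dots> = e"
    using sum_degrees[OF bigraph_swap[OF G]] card_edges_swap[OF G]
    unfolding d_def e_def by (simp flip: of_nat_sum)
  finally have Te: "T \<le> e" .
  have "T \<le> (\<Sum>b\<in>R `` {a}. real m)" unfolding T_def using sub dm by (intro sum_mono) auto
  then have Tm: "T \<le> d a * m" unfolding d_def by simp
  have eq: "(\<Sum>b\<in>R `` {a}. 1 + d b / d a) = d a + T / d a"
    unfolding T_def by (simp add: sum.distrib sum_divide_distrib d_def)
  show ?thesis
  proof (cases "d a = 0")
    case True
    then show ?thesis unfolding eq using e0 by simp
  next
    case False
    then have D: "0 < d a" unfolding d_def by simp
    show ?thesis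
    proof (cases "d a * m \<le> e")
      case True
      then have "d a \<le> e / m" using m0 by (simp add: field_simps)
      moreover have "T / d a \<le> m" using Tm D by (simp add: field_simps)
      ultimately show ?thesis unfolding eq by linarith
    next
      case False
      have "0 \<le> (m - d a) * (d a * m - e)" using False da by simp
      then have "d a + e / d a \<le> e / m + m" using D m0 by (simp add: field_simps)
      moreover have "T / d a \<le> e / d a" using Te D by (simp add: divide_right_mono)
      ultimately show ?thesis unfolding eq by linarith
    qed
  qed
qed

lemma weighted_square:
  fixes x y p q :: real
  assumes "0 < p" "0 < q"
  shows "x * y \<le> x\<^sup>2 * (q / p) / 2 + y\<^sup>2 * (p / q) / 2"
proof -
  have "x\<^sup>2 * (q / p) / 2 + y\<^sup>2 * (p / q) / 2 - x * y = (x * q - y * p)\<^sup>2 / (2 * p * q)"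
    using assms by (simp add: power2_eq_square field_simps)
  also have "\<dots> \<ge> 0" using assms by simp
  finally show ?thesis by simp
qed

lemma bigraph_finite: "balanced_bigraph U V R \<Longrightarrow> finite R"
  unfolding balanced_bigraph_def by (metis finite_Un finite_cartesian_product finite_subset)

lemma bigraph_Sigma: "balanced_bigraph U V R \<Longrightarrow> R = (SIGMA a:U \<union> V. R `` {a})"
  unfolding balanced_bigraph_def by auto

lemma sum_arcs:
  assumes G: "balanced_bigraph U V R"
  shows "(\<Sum>(a, b)\<in>R. g a b) = (\<Sum>a\<in>U \<union> V. \<Sum>b\<in>R `` {a}. g a b)"
proof -
  have "\<forall>a\<in>U \<union> V. finite (R `` {a})"
    using bigraph_nbrs(2)[OF G] bigraph_nbrs(2)[OF bigraph_swap[OF G]] by auto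
  moreover have "finite (U \<union> V)" using G unfolding balanced_bigraph_def by auto
  ultimately show ?thesis by (subst bigraph_Sigma[OF G]) (simp add: sum.Sigma)
qed

lemma sum_arcs_swap:
  assumes G: "balanced_bigraph U V R"
  shows "(\<Sum>(a, b)\<in>R. g b a) = (\<Sum>(a, b)\<in>R. g a b)"
  by (rule sum.reindex_bij_witness[of _ prod.swap prod.swap])
     (use bigraph_sym[OF G] in \<open>auto\<close>)

text \<open>
  The form of \<open>A + D\<close>. Splitting each product by the weighted inequality
  \<open>2 * x * y \<le> x\<^sup>2 * (q / p) + y\<^sup>2 * (p / q)\<close>, where \<open>p\<close> and \<open>q\<close> are the degrees of the two ends,
  makes the form diagonal, with the sums in \<open>signless_row_bound\<close> as coefficients.
\<close>

lemma signless_form_bound: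
  fixes f :: "'a \<Rightarrow> real"
  assumes G: "balanced_bigraph U V R"
  defines "e \<equiv> real (card (R \<inter> U \<times> V))"
  shows "(\<Sum>(a, b)\<in>R. f a * f b + (f a)\<^sup>2) \<le> (e / card U + card U) * (\<Sum>a\<in>U \<union> V. (f a)\<^sup>2)"
proof -
  define d where "d z = real (card (R `` {z}))" for z
  have pos: "0 < d a" if "(a, b) \<in> R" for a b
  proof -
    have "finite (R `` {a})" using finite_imageI[OF bigraph_finite[OF G], of snd]
      by (rule finite_subset[rotated]) force
    then show ?thesis using that unfolding d_def by (auto simp: card_gt_0_iff)
  qed
  have "(\<Sum>(a, b)\<in>R. f a * f b + (f a)\<^sup>2)
      \<le> (\<Sum>(a, b)\<in>R. (f a)\<^sup>2 * (d b / d a) / 2 + (f b)\<^sup>2 * (d a / d b) / 2 + (f a)\<^sup>2)"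
  proof (intro sum_mono, clarify)
    fix a b assume "(a, b) \<in> R"
    then have "0 < d a" "0 < d b" using pos bigraph_sym[OF G] by blast+
    from add_right_mono[OF weighted_square[OF this, of "f a" "f b"]]
    show "f a * f b + (f a)\<^sup>2 \<le> (f a)\<^sup>2 * (d b / d a) / 2 + (f b)\<^sup>2 * (d a / d b) / 2 + (f a)\<^sup>2" .
  qed
  also have "\<dots> = (\<Sum>(a, b)\<in>R. (f a)\<^sup>2 * (d b / d a) / 2) + (\<Sum>(a, b)\<in>R. (f b)\<^sup>2 * (d a / d b) / 2)
      + (\<Sum>(a, b)\<in>R. (f a)\<^sup>2)"
    by (simp add: sum.distrib case_prod_unfold)
  also have "(\<Sum>(a, b)\<in>R. (f b)\<^sup>2 * (d a / d b) / 2) = (\<Sum>(a, b)\<in>R. (f a)\<^sup>2 * (d b / d a) / 2)"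
    by (rule sum_arcs_swap[OF G, where g = "\<lambda>a b. (f a)\<^sup>2 * (d b / d a) / 2"])
  also have "(\<Sum>(a, b)\<in>R. (f a)\<^sup>2 * (d b / d a) / 2) + (\<Sum>(a, b)\<in>R. (f a)\<^sup>2 * (d b / d a) / 2)
      + (\<Sum>(a, b)\<in>R. (f a)\<^sup>2) = (\<Sum>(a, b)\<in>R. (f a)\<^sup>2 * (1 + d b / d a))"
    unfolding case_prod_unfold sum.distrib[symmetric]
    by (intro sum.cong refl) (simp only: field_sum_of_halves distrib_left mult_1_right add.commute)
  also have "\<dots> = (\<Sum>a\<in>U \<union> V. (f a)\<^sup>2 * (\<Sum>b\<in>R `` {a}. 1 + d b / d a))"
    unfolding sum_arcs[OF G] sum_distrib_left ..
  also have "\<dots> \<le> (\<Sum>a\<in>U \<union> V. (f a)\<^sup>2 * (e / card U + card U))"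
  proof (intro sum_mono mult_left_mono)
    fix a assume "a \<in> U \<union> V"
    then show "(\<Sum>b\<in>R `` {a}. 1 + d b / d a) \<le> e / card U + card U"
    proof
      assume "a \<in> U"
      from signless_row_bound[OF G this refl] show ?thesis unfolding d_def e_def .
    next
      assume "a \<in> V"
      moreover have "card V = card U" using G unfolding balanced_bigraph_def by simp
      ultimately show ?thesis
        using signless_row_bound[OF bigraph_swap[OF G], of a] card_edges_swap[OF G]
        unfolding d_def e_def by simp
    qed
  qed simp
  also have "\<dots> = (e / card U + card U) * (\<Sum>a\<in>U \<union> V. (f a)\<^sup>2)"
    by (simp add: sum_distrib_left mult.commute)
  finally show ?thesis .
qed

text \<open>
  Cauchy-Schwarz over the edges, followed by the comparison of the edge sum of squared products with
  the sum over all pairs in \<open>U \<times> V\<close>, which factors.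
\<close>

lemma adjacency_form_bound:
  fixes f :: "'a \<Rightarrow> real"
  assumes G: "balanced_bigraph U V R"
  shows "(\<Sum>(a, b)\<in>R. f a * f b) \<le> sqrt (card (R \<inter> U \<times> V)) * (\<Sum>a\<in>U \<union> V. (f a)\<^sup>2)"
proof -
  have fin: "finite U" "finite V" and dis: "U \<inter> V = {}" using G unfolding balanced_bigraph_def by auto
  let ?E = "R \<inter> U \<times> V"
  define X where "X = (\<Sum>a\<in>U. (f a)\<^sup>2)"
  define Y where "Y = (\<Sum>a\<in>V. (f a)\<^sup>2)"
  define s where "s = (\<Sum>(a, b)\<in>?E. f a * f b)"
  have X0: "0 \<le> X" "0 \<le> Y" unfolding X_def Y_def by (auto intro: sum_nonneg)
  have split: "R = ?E \<union> R \<inter> V \<times> U" "?E \<inter> (R \<inter> V \<times> U) = {}"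
    using G unfolding balanced_bigraph_def by auto
  have "(\<Sum>(a, b)\<in>R. f a * f b) = s + (\<Sum>(a, b)\<in>R \<inter> V \<times> U. f a * f b)"
    unfolding s_def using bigraph_finite[OF G] split(2) by (subst split(1), subst sum.union_disjoint) auto
  also have "(\<Sum>(a, b)\<in>R \<inter> V \<times> U. f a * f b) = s"
    unfolding s_def by (rule sum.reindex_bij_witness[of _ prod.swap prod.swap])
      (use bigraph_sym[OF G] in \<open>auto\<close>)
  finally have 1: "(\<Sum>(a, b)\<in>R. f a * f b) = 2 * s" by simp
  have "s\<^sup>2 = (\<Sum>p\<in>?E. 1 * (f (fst p) * f (snd p)))\<^sup>2" unfolding s_def by (simp add: case_prod_unfold)
  also have "\<dots> \<le> (\<Sum>p\<in>?E. 1\<^sup>2) * (\<Sum>p\<in>?E. (f (fst p) * f (snd p))\<^sup>2)" by (rule Cauchy_Schwarz_ineq_sum)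
  also have "\<dots> \<le> card ?E * (\<Sum>p\<in>U \<times> V. (f (fst p) * f (snd p))\<^sup>2)"
    using fin by (simp, intro mult_left_mono sum_mono2) auto
  also have "(\<Sum>p\<in>U \<times> V. (f (fst p) * f (snd p))\<^sup>2) = X * Y"
    unfolding X_def Y_def sum_product sum.cartesian_product
    by (simp add: case_prod_unfold power_mult_distrib)
  also have "real (card ?E) * (X * Y) \<le> card ?E * ((X + Y) / 2)\<^sup>2"
    using zero_le_power2[of "X - Y"]
    by (intro mult_left_mono) (auto simp: power2_eq_square field_simps)
  also have "\<dots> = (sqrt (card ?E) * ((X + Y) / 2))\<^sup>2"
    unfolding power_mult_distrib by simp
  finally have "s\<^sup>2 \<le> (sqrt (card ?E) * ((X + Y) / 2))\<^sup>2" .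
  moreover have "0 \<le> sqrt (card ?E) * ((X + Y) / 2)" using X0 by simp
  ultimately have "s \<le> sqrt (card ?E) * ((X + Y) / 2)" by (rule power2_le_imp_le)
  then show ?thesis using 1 fin dis unfolding X_def Y_def by (simp add: sum.union_disjoint)
qed

lemma balanced_bipartite_bigraph:
  assumes "balanced_bipartite G U V"
  shows "balanced_bigraph U V (parcs G)"
proof -
  interpret pair_graph G using assms unfolding balanced_bipartite_def by simp
  have "finite U" "finite V"
    using assms pair_finite_verts unfolding balanced_bipartite_def by (metis finite_Un)+
  moreover have "sym (parcs G)" using pair_sym_arcs unfolding symmetric_def by simp
  ultimately show ?thesis using assms unfolding balanced_bipartite_def balanced_bigraph_def by simp
qed

lemma out_degree_eq_card_nbrs: "out_degree (with_proj G) u = card (parcs G `` {u})"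
proof -
  have "out_arcs (with_proj G) u = {u} \<times> parcs G `` {u}" by (auto simp: out_arcs_def)
  then show ?thesis by (simp add: out_degree_def card_cartesian_product)
qed

text \<open>
  Evaluate the form of \<open>A + \<alpha> D = \<alpha> (A + D) + (1 - \<alpha>) A\<close> on an eigenvector and bound its two parts
  separately. As a function of \<open>e\<close> the right-hand side is the one that defines \<open>\<Theta>\<^sub>0\<close>.
\<close>

lemma Theta_le:
  assumes B: "balanced_bipartite G U V" and ne: "U \<noteq> {}" and \<alpha>: "0 \<le> \<alpha>" "\<alpha> \<le> 1"
  defines "e \<equiv> real (card (parcs G \<inter> U \<times> V))"
  shows "Theta G \<alpha> \<le> \<alpha> * (e / card U + card U) + (1 - \<alpha>) * sqrt e"
proof -
  let ?R = "parcs G"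
  let ?vs = "vertex_list G"
  let ?M = "adjacency_matrix G ?vs + \<alpha> \<cdot>\<^sub>m degree_matrix G ?vs"
  have pg: "pair_graph G" and W: "U \<union> V = pverts G" using B unfolding balanced_bipartite_def by auto
  note G = balanced_bipartite_bigraph[OF B]
  have vs: "distinct ?vs" "set ?vs = U \<union> V" using vertex_list[OF pg] W by auto
  have fin: "finite (U \<union> V)" using G unfolding balanced_bigraph_def by auto
  let ?n = "length ?vs"
  have M: "?M \<in> carrier_mat ?n ?n" unfolding adjacency_matrix_def degree_matrix_def by auto
  have n: "0 < ?n" using vs(2) ne by (metis Un_empty length_greater_0_conv list.set(1))
  have sym: "?M $$ (i, j) = ?M $$ (j, i)" if "i < ?n" "j < ?n" for i j
    using that bigraph_sym[OF G] by (auto simp: adjacency_matrix_def degree_matrix_def)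
  have "spectrum ?M \<noteq> {}" by (rule symmetric_real_mat_has_eigenvalue[OF M n sym])
  then have "Theta G \<alpha> \<in> spectrum ?M"
    unfolding Theta_def using card_finite_spectrum(1)[OF M] by (rule Max_in[rotated])
  define l where "l = Theta G \<alpha>"
  have "eigenvalue ?M l" using \<open>Theta G \<alpha> \<in> spectrum ?M\<close> unfolding spectrum_def l_def by simp
  then obtain f where f: "\<exists>v\<in>U \<union> V. f v \<noteq> 0"
    and eq: "\<And>u. u \<in> U \<union> V \<Longrightarrow> (\<Sum>v\<in>U \<union> V. if (u, v) \<in> ?R then f v else 0)
         + \<alpha> * real (card (?R `` {u})) * f u = l * f u"
    unfolding eigenvalue_vertex_indexed[OF vs(1)] vs(2) out_degree_eq_card_nbrs by blast
  define N where "N = (\<Sum>u\<in>U \<union> V. (f u)\<^sup>2)"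
  have N: "0 < N"
  proof -
    obtain v where v: "v \<in> U \<union> V" "f v \<noteq> 0" using f by blast
    have "0 < (f v)\<^sup>2" using v by simp
    also have "\<dots> \<le> N" unfolding N_def using v fin by (intro member_le_sum) auto
    finally show ?thesis .
  qed
  have "l * N = (\<Sum>u\<in>U \<union> V. f u * (l * f u))"
    unfolding N_def by (simp add: sum_distrib_left power2_eq_square ac_simps)
  also have "\<dots> = (\<Sum>u\<in>U \<union> V. \<Sum>v\<in>?R `` {u}. f u * f v + \<alpha> * (f u)\<^sup>2)"
  proof (intro sum.cong refl)
    fix u assume u: "u \<in> U \<union> V"
    have "(U \<union> V) \<inter> {v. (u, v) \<in> ?R} = ?R `` {u}" using G unfolding balanced_bigraph_def by auto
    then have "(\<Sum>v\<in>U \<union> V. if (u, v) \<in> ?R then f v else 0) = (\<Sum>v\<in>?R `` {u}. f v)"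
      using fin by (simp add: sum.If_cases)
    then have "l * f u = (\<Sum>v\<in>?R `` {u}. f v) + \<alpha> * real (card (?R `` {u})) * f u"
      using eq[OF u] by simp
    then show "f u * (l * f u) = (\<Sum>v\<in>?R `` {u}. f u * f v + \<alpha> * (f u)\<^sup>2)"
      by (simp add: sum.distrib algebra_simps power2_eq_square sum_distrib_left)
  qed
  also have "\<dots> = (\<Sum>(u, v)\<in>?R. f u * f v + \<alpha> * (f u)\<^sup>2)" by (rule sum_arcs[OF G, symmetric])
  also have "\<dots> = (\<Sum>(u, v)\<in>?R. \<alpha> * (f u * f v + (f u)\<^sup>2) + (1 - \<alpha>) * (f u * f v))"
    by (intro sum.cong) (auto simp: algebra_simps)
  also have "\<dots> = \<alpha> * (\<Sum>(u, v)\<in>?R. f u * f v + (f u)\<^sup>2) + (1 - \<alpha>) * (\<Sum>(u, v)\<in>?R. f u * f v)"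
    by (simp only: case_prod_unfold sum_distrib_left sum.distrib[symmetric])
  also have "\<dots> \<le> \<alpha> * ((e / card U + card U) * N) + (1 - \<alpha>) * (sqrt e * N)"
    using signless_form_bound[OF G, of f] adjacency_form_bound[OF G, of f] \<alpha>
    unfolding e_def N_def by (intro add_mono mult_left_mono) auto
  also have "\<dots> = (\<alpha> * (e / card U + card U) + (1 - \<alpha>) * sqrt e) * N" by (simp add: algebra_simps)
  finally show ?thesis using N unfolding l_def by simp
qed

section \<open>Embedding into the exceptional graph\<close>

lemma initial_segment_enumeration:
  assumes "finite X" "C \<subseteq> X"
  shows "\<exists>f. bij_betw f X {..<card X} \<and> (\<forall>x\<in>X. f x < card C \<longleftrightarrow> x \<in> C)"
proof -
  have fin: "finite C" "finite (X - C)" using assms by (auto intro: finite_subset)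
  obtain f where f: "bij_betw f C {0..<card C}" using ex_bij_betw_finite_nat[OF fin(1)] by blast
  obtain g where g: "bij_betw g (X - C) {0..<card (X - C)}"
    using ex_bij_betw_finite_nat[OF fin(2)] by blast
  have cX: "card X = card C + card (X - C)"
    using assms fin by (simp add: card_Diff_subset card_mono)
  define h where "h x = (if x \<in> C then f x else card C + g x)" for x
  have fl: "f x < card C" if "x \<in> C" for x using bij_betwE[OF f] that by auto
  have gl: "g x < card (X - C)" if "x \<in> X" "x \<notin> C" for x using bij_betwE[OF g] that by auto
  have "inj_on h X"
  proof (rule inj_onI)
    fix x y assume xy: "x \<in> X" "y \<in> X" "h x = h y"
    show "x = y"
    proof (cases "x \<in> C"; cases "y \<in> C")
      assume "x \<in> C" "y \<in> C"
      then show ?thesis using xy bij_betw_imp_inj_on[OF f] by (auto simp: h_def dest: inj_onD)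
    next
      assume "x \<notin> C" "y \<notin> C"
      then show ?thesis using xy bij_betw_imp_inj_on[OF g] by (auto simp: h_def dest: inj_onD)
    qed (use xy fl in \<open>force simp: h_def\<close>)+
  qed
  moreover have "h ` X \<subseteq> {..<card X}"
    using fl gl cX by (force simp: h_def)
  ultimately have "bij_betw h X {..<card X}"
    unfolding bij_betw_def by (metis card_image card_lessThan card_subset_eq finite_lessThan)
  moreover have "\<forall>x\<in>X. h x < card C \<longleftrightarrow> x \<in> C" using fl by (auto simp: h_def)
  ultimately show ?thesis by blast
qed

text \<open>
  Number \<open>Y\<close> so that \<open>A\<close> comes first, and \<open>X\<close> so that \<open>N\<close> is contained in the last \<open>k\<close> positions.
  The edges deleted from the complete bipartite graph then join \<open>A\<close> to vertices outside of \<open>N\<close>, and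
  \<open>G\<close> has no such edges.
\<close>

lemma subgraph_Z_graph:
  assumes B: "balanced_bipartite G X Y" and cX: "card X = n" and cY: "card Y = a + b" and kn: "k \<le> n"
    and A: "A \<subseteq> Y" "card A = b" and N: "parcs G `` A \<subseteq> N" "N \<subseteq> X" "card N \<le> k"
  shows "subgraph_up_to_iso G (Z_graph n k a b)"
proof -
  let ?F = "Z_graph n k a b"
  have pg: "pair_graph G" and W: "X \<union> Y = pverts G" and dis: "X \<inter> Y = {}"
    and arcs: "parcs G \<subseteq> X \<times> Y \<union> Y \<times> X"
    using B unfolding balanced_bipartite_def by auto
  note G = balanced_bipartite_bigraph[OF B]
  interpret pair_graph G by fact
  have fin: "finite X" "finite Y" using G unfolding balanced_bigraph_def by auto
  have "card (X - N) \<ge> n - k"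
    using N(2,3) fin cX diff_card_le_card_Diff[of N X] by (meson diff_le_mono2 finite_subset order_trans)
  then obtain C where C: "C \<subseteq> X - N" "card C = n - k" by (metis obtain_subset_with_card_n)
  have "C \<subseteq> X" using C by auto
  obtain f where f: "bij_betw f X {..<n}" "\<And>x. x \<in> X \<Longrightarrow> f x < n - k \<longleftrightarrow> x \<in> C"
    using initial_segment_enumeration[OF fin(1) \<open>C \<subseteq> X\<close>] C(2) cX by auto
  obtain g where g: "bij_betw g Y {..<a + b}" "\<And>y. y \<in> Y \<Longrightarrow> g y < b \<longleftrightarrow> y \<in> A"
    using initial_segment_enumeration[OF fin(2) A(1)] A(2) cY by auto
  define h where "h z = (if z \<in> X then Inl (f z) else Inr (g z))" for z
  define hh where "hh = (\<lambda>(u, v). (h u, h v))"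
  define H where "H = \<lparr> pverts = h ` pverts G, parcs = hh ` parcs G \<rparr>"
  have hX: "h x = Inl (f x)" if "x \<in> X" for x using that unfolding h_def by simp
  have hY: "h y = Inr (g y)" if "y \<in> Y" for y using that dis unfolding h_def by auto
  have fl: "f x < n" if "x \<in> X" for x using bij_betwE[OF f(1)] that by auto
  have gl: "g y < a + b" if "y \<in> Y" for y using bij_betwE[OF g(1)] that by auto
  have edge: "f x \<ge> n - k \<or> g y \<ge> b" if "(y, x) \<in> parcs G" "x \<in> X" "y \<in> Y" for x y
    using f(2)[of x] g(2)[of y] that C(1) N(1) by (meson DiffD2 ImageI not_le subset_eq)
  have injh: "inj_on h (pverts G)"
    using bij_betw_imp_inj_on[OF f(1)] bij_betw_imp_inj_on[OF g(1)]
    unfolding W[symmetric] by (auto simp: h_def inj_on_def)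
  have arcsH: "hh ` parcs G \<subseteq> parcs ?F"
  proof (rule subrelI)
    fix s t assume "(s, t) \<in> hh ` parcs G"
    then obtain u v where uv: "(u, v) \<in> parcs G" "s = h u" "t = h v" unfolding hh_def by auto
    have vu: "(v, u) \<in> parcs G" using bigraph_sym[OF G uv(1)] .
    from arcs uv(1) consider "u \<in> X" "v \<in> Y" | "u \<in> Y" "v \<in> X" by auto
    then show "(s, t) \<in> parcs ?F"
    proof cases
      case 1
      then show ?thesis using uv hX hY fl gl edge[OF vu] by (force simp: Z_graph_def Let_def)
    next
      case 2
      then show ?thesis using uv hX hY fl gl edge[OF uv(1)] by (force simp: Z_graph_def Let_def)
    qed
  qed
  have vertsH: "h ` pverts G \<subseteq> pverts ?F"
    unfolding W[symmetric] using hX hY fl gl by (auto simp: Z_graph_def Let_def)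
  have "wf_digraph (with_proj H)"
    by unfold_locales (auto simp: H_def hh_def intro: in_arcsD1 in_arcsD2)
  moreover have "wf_digraph (with_proj ?F)"
    by unfold_locales (auto simp: Z_graph_def Let_def)
  ultimately have "subgraph (with_proj H) (with_proj ?F)"
    using vertsH arcsH unfolding subgraph_def compatible_def by (simp add: H_def)
  moreover have "digraph_iso (with_proj G) (with_proj H)"
  proof -
    define I where "I = \<lparr> iso_verts = h, iso_arcs = hh, iso_head = snd, iso_tail = fst \<rparr>"
    have "inj_on hh (parcs G)"
    proof (rule inj_onI)
      fix e e' assume e: "e \<in> parcs G" "e' \<in> parcs G" "hh e = hh e'"
      then have "h (fst e) = h (fst e')" "h (snd e) = h (snd e')"
        unfolding hh_def by (simp_all add: case_prod_unfold)
      then have "fst e = fst e'" "snd e = snd e'"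
        using e arc_fst_in_verts arc_snd_in_verts by (auto dest: inj_onD[OF injh])
      then show "e = e'" by (rule prod_eqI)
    qed
    then have "digraph_isomorphism I"
      unfolding digraph_isomorphism_def using injh
      by (auto simp: I_def hh_def wf_digraph_axioms)
    moreover have "with_proj H = app_iso I (with_proj G)"
      by (simp add: app_iso_def I_def H_def with_proj_def)
    ultimately show ?thesis unfolding digraph_iso_def by blast
  qed
  ultimately show ?thesis unfolding subgraph_up_to_iso_def by blast
qed

section \<open>The spectral hypothesis and the deletion of vertices\<close>

text \<open>
  Translates cyclic vertex lists into arc lists. The end point \<open>z\<close> is kept general for the induction;
  for a cycle it is \<open>hd c\<close>.
\<close>

lemma arcs_of_vertex_cycle:
  assumes "c \<noteq> []"
  shows "pcas (hd c) (zip c (tl c @ [z])) z" "pawalk_verts (hd c) (zip c (tl c @ [z])) = c @ [z]"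
    "successively (\<lambda>a b. (a, b) \<in> R) c \<Longrightarrow> (last c, z) \<in> R \<Longrightarrow> set (zip c (tl c @ [z])) \<subseteq> R"
  using assms
proof (induction c rule: list_nonempty_induct)
  case (cons x xs)
  then obtain y ys where "xs = y # ys" by (cases xs) auto
  { case 1 then show ?case using cons \<open>xs = y # ys\<close> by simp }
  { case 2 then show ?case using cons \<open>xs = y # ys\<close> by simp }
  { case 3 then show ?case using cons \<open>xs = y # ys\<close> by simp }
qed auto

lemma has_spanning_cycleI:
  assumes ham: "hamiltonian (pverts G) (parcs G)" and card: "3 \<le> card (pverts G)"
  shows "has_spanning_cycle G"
proof -
  obtain c where c: "distinct c" "set c = pverts G" "successively (\<lambda>a b. (a, b) \<in> parcs G) c"
      "(last c, hd c) \<in> parcs G"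
    using ham unfolding hamiltonian_def by blast
  have len: "3 \<le> length c" using c(1,2) card by (metis distinct_card)
  then have ne: "c \<noteq> []" by auto
  define p where "p = zip c (tl c @ [hd c])"
  note p = arcs_of_vertex_cycle[OF ne, where z = "hd c", folded p_def]
  have lp: "length p = length c" unfolding p_def using ne by simp
  have "distinct (tl (c @ [hd c]))" using c(1) ne by (cases c) auto
  then have "pre_digraph.cycle (with_proj G) p"
    unfolding pre_digraph.cycle_def pre_digraph.awalk_def cas_with_proj_eq awalk_verts_with_proj_eq
    using p(1,2) p(3)[OF c(3,4)] c(2) ne lp by (intro exI[of _ "hd c"]) auto
  moreover have "fst ` set p = pverts G"
  proof -
    have "map fst p = c" unfolding p_def using ne by (intro map_fst_zip) simp
    then show ?thesis using c(2) by (metis list.set_map)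
  qed
  ultimately show ?thesis unfolding has_spanning_cycle_def using lp len by auto
qed

text \<open>
  \<open>\<Theta>\<^sub>0\<close> is the bound on the largest eigenvalue for \<open>\<epsilon>\<^sub>0\<close> edges, and the bound grows with the number
  of edges, so \<open>G\<close> has more than \<open>\<epsilon>\<^sub>0\<close> edges. The right-hand side is \<open>n\<^sup>2 - \<epsilon>\<^sub>0\<close>.
\<close>

lemma few_missing_edges:
  assumes B: "balanced_bipartite G U V" and n: "card U = n" and kn: "k < n" and qk: "q \<le> k"
    and \<alpha>: "0 \<le> \<alpha>" "\<alpha> \<le> 1" and Theta: "Theta0 \<alpha> n k (int q + 1) < Theta G \<alpha>"
  shows "card (U \<times> V - parcs G) < (k - q + 1) * (n - k - 1)"
proof -
  let ?E = "parcs G \<inter> U \<times> V"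
  note G = balanced_bipartite_bigraph[OF B]
  have fin: "finite U" "finite V" and cV: "card V = n" using G n unfolding balanced_bigraph_def by auto
  have "U \<noteq> {}" using n kn by auto
  define e where "e = card ?E"
  define E0 where "E0 = epsilon0 n k (int q + 1)"
  have "E0 < int e"
  proof (rule ccontr)
    assume "\<not> E0 < int e"
    then have le: "real e \<le> real_of_int E0" by linarith
    have "Theta G \<alpha> \<le> \<alpha> * (real e / n + n) + (1 - \<alpha>) * sqrt e"
      using Theta_le[OF B \<open>U \<noteq> {}\<close> \<alpha>] n unfolding e_def by simp
    also have "\<dots> \<le> \<alpha> * (real_of_int E0 / n + n) + (1 - \<alpha>) * sqrt (real_of_int E0)"
      using le \<alpha> by (intro add_mono mult_left_mono divide_right_mono) auto
    also have "\<dots> = Theta0 \<alpha> n k (int q + 1)" unfolding Theta0_def E0_def ..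
    finally show False using Theta by simp
  qed
  have "U \<times> V - parcs G = U \<times> V - ?E" by auto
  moreover have "card (U \<times> V - ?E) = card (U \<times> V) - e"
    unfolding e_def using fin by (intro card_Diff_subset) (auto intro: finite_subset)
  moreover have "e \<le> card (U \<times> V)" unfolding e_def using fin by (intro card_mono) auto
  ultimately have mis: "int (card (U \<times> V - parcs G)) = int n * int n - int e"
    using n cV by (simp add: card_cartesian_product of_nat_diff)
  obtain t where t: "k = q + t" using qk le_Suc_ex by blast
  obtain w where w: "n = k + 1 + w" using kn by (metis Suc_eq_plus1 Suc_leI le_Suc_ex)
  have "int n * int n - E0 = (int t + 1) * int w"
    unfolding E0_def epsilon0_def w t by (simp add: algebra_simps)
  then have "int (card (U \<times> V - parcs G)) < (int t + 1) * int w"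
    using mis \<open>E0 < int e\<close> by linarith
  also have "\<dots> = int ((t + 1) * w)" by (simp add: distrib_right)
  finally have "int (card (U \<times> V - parcs G)) < int ((t + 1) * w)" .
  then have "card (U \<times> V - parcs G) < (t + 1) * w" unfolding of_nat_less_iff .
  then show ?thesis using t w by simp
qed

text \<open>
  Undoing the deletion of \<open>S\<close> gives the tight set at most \<open>q\<close> further neighbours, those in \<open>S \<inter> V\<close>,
  hence at most \<open>k\<close> in all. These are the parameters of \<open>F\<close>, which has \<open>b = k - q\<close>.
\<close>

lemma tight_set_embeds:
  assumes B: "balanced_bipartite G U V" and n: "card U = n" and kn: "k < n" and qk: "q \<le> k"
    and S: "card (S \<inter> V) = q" and A: "A \<subseteq> U - S" "card A = k - q"
    and N: "N \<subseteq> V" "card N \<le> k - q" "\<And>a v. a \<in> A \<Longrightarrow> (a, v) \<in> parcs G \<Longrightarrow> v \<notin> S \<Longrightarrow> v \<in> N"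
  shows "subgraph_up_to_iso G (F_graph n k (int q + 1))"
proof -
  have B': "balanced_bipartite G V U" using B unfolding balanced_bipartite_def by auto
  note G = balanced_bipartite_bigraph[OF B]
  have cV: "card V = n" using G n unfolding balanced_bigraph_def by auto
  have "card (N \<union> S \<inter> V) \<le> k" using card_Un_le[of N "S \<inter> V"] N(2) S qk by linarith
  moreover have "parcs G `` A \<subseteq> N \<union> S \<inter> V"
  proof
    fix v assume "v \<in> parcs G `` A"
    then obtain a where a: "a \<in> A" "(a, v) \<in> parcs G" by auto
    moreover have "v \<in> V" using bigraph_nbrs(1)[OF G, of a] a A(1) by auto
    ultimately show "v \<in> N \<union> S \<inter> V" using N(3) by blast
  qed
  moreover have "card U = (n + q - k) + (k - q)" using n kn qk by simp
  ultimately have "subgraph_up_to_iso G (Z_graph n k (n + q - k) (k - q))"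
    using A N(1) kn by (intro subgraph_Z_graph[OF B' cV, where A = A and N = "N \<union> S \<inter> V"]) auto
  moreover have "nat (int n + (int q + 1) - int k - 1) = n + q - k" "nat (int k + 1 - (int q + 1)) = k - q"
    using kn qk by auto
  ultimately show ?thesis unfolding F_graph_def by simp
qed

theorem corollary1p19:
  fixes q k n :: nat and \<alpha> :: real
    and G :: "'a pair_pre_digraph" and U V :: "'a set"
  assumes "balanced_bipartite G U V"
    and "card (pverts G) = 2 * n"
    and "2 * n \<ge> 6 * k + 8"
    and "min_degree G \<ge> k"
    and "k \<ge> q + 1"
    and "Theta G \<alpha> > Theta0 \<alpha> n k (int q + 1)"
    and "0 \<le> \<alpha>" and "\<alpha> \<le> 1"
    and "\<not> subgraph_up_to_iso G (F_graph n k (int q + 1))"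
  shows "qq_Hamiltonian q G U V"
  unfolding qq_Hamiltonian_def
proof (intro allI impI)
  fix S assume S: "S \<subseteq> pverts G" and "card (S \<inter> U) = q \<and> card (S \<inter> V) = q"
  then have SU: "card (S \<inter> U) = q" and SV: "card (S \<inter> V) = q" by auto
  have W: "U \<union> V = pverts G" using assms(1) unfolding balanced_bipartite_def by simp
  note G = balanced_bipartite_bigraph[OF assms(1)]
  have fin: "finite U" "finite V" and dis: "U \<inter> V = {}" and cUV: "card U = card V"
    using G unfolding balanced_bigraph_def by auto
  have "card (U \<union> V) = 2 * card U" using fin dis cUV by (simp add: card_Un_disjoint)
  then have cU: "card U = n" and cV: "card V = n" using assms(2) W cUV by auto
  have kn: "k < n" and qk: "q \<le> k" using assms(3,5) by auto
  let ?U = "U - S" and ?V = "V - S"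
  let ?H = "delete_vertices G S"
  define R where "R = parcs ?H"
  have R: "R = {e \<in> parcs G. fst e \<notin> S \<and> snd e \<notin> S}" unfolding R_def delete_vertices_def by simp
  have WH: "pverts ?H = ?U \<union> ?V" unfolding delete_vertices_def using W by auto
  have cUS: "card ?U = n - q"
    using SU cU fin card_Diff_subset_Int[of U S] by (simp add: Int_commute)
  have cVS: "card ?V = n - q"
    using SV cV fin card_Diff_subset_Int[of V S] by (simp add: Int_commute)
  have GH: "balanced_bigraph ?U ?V R"
    using G cUS cVS unfolding balanced_bigraph_def R sym_def by auto
  have degG: "k \<le> card (parcs G `` {z})" if "z \<in> U \<union> V" for z
  proof -
    have "min_degree G \<le> out_degree (with_proj G) z"
      unfolding min_degree_def W[symmetric] using fin that by (intro Min_le) auto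
    then show ?thesis using assms(4) unfolding out_degree_eq_card_nbrs by linarith
  qed
  have degH: "k - q \<le> card (R `` {z})" if "z \<in> ?U \<union> ?V" for z
  proof -
    \<comment> \<open>A vertex loses only neighbours on the opposite side, where \<open>S\<close> has \<open>q\<close> vertices.\<close>
    have "\<exists>T. finite T \<and> card T = q \<and> parcs G `` {z} - T \<subseteq> R `` {z}"
    proof (cases "z \<in> U")
      case True
      then have "parcs G `` {z} - S \<inter> V \<subseteq> R `` {z}"
        using that bigraph_nbrs(1)[OF G True] unfolding R by auto
      then show ?thesis using SV fin by blast
    next
      case False
      then have z: "z \<in> V" using that by auto
      then have "parcs G `` {z} - S \<inter> U \<subseteq> R `` {z}"
        using that bigraph_nbrs(1)[OF bigraph_swap[OF G] z] unfolding R by auto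
      then show ?thesis using SU fin by blast
    qed
    then obtain T where T: "finite T" "card T = q" "parcs G `` {z} - T \<subseteq> R `` {z}" by blast
    have "finite (R `` {z})"
      using bigraph_nbrs(2)[OF GH] bigraph_nbrs(2)[OF bigraph_swap[OF GH]] that by auto
    then have "card (parcs G `` {z} - T) \<le> card (R `` {z})" using T(3) by (rule card_mono)
    moreover have "card (parcs G `` {z}) - card T \<le> card (parcs G `` {z} - T)"
      by (rule diff_card_le_card_Diff[OF T(1)])
    ultimately show ?thesis using degG[of z] that T(2) by auto
  qed
  have missing: "card (?U \<times> ?V - R) < (k - q + 1) * (card ?U - (k - q) - 1)"
  proof -
    have "card (?U \<times> ?V - R) \<le> card (U \<times> V - parcs G)"
      using fin by (intro card_mono) (auto simp: R)
    also have "\<dots> < (k - q + 1) * (n - k - 1)"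
      by (rule few_missing_edges[OF assms(1) cU kn qk assms(7,8,6)])
    finally show ?thesis unfolding cUS using kn qk by simp
  qed
  have two: "2 \<le> card ?U" unfolding cUS using assms(3,5) by linarith
  have "hamiltonian (?U \<union> ?V) R"
  proof (rule ccontr)
    assume "\<not> hamiltonian (?U \<union> ?V) R"
    then have "\<exists>A N. (A \<subseteq> ?U \<and> N \<subseteq> ?V \<or> A \<subseteq> ?V \<and> N \<subseteq> ?U) \<and> card A = k - q
        \<and> card N \<le> k - q \<and> R `` A \<subseteq> N"
      by (intro tight_set_if_not_hamiltonian[OF GH two _ missing] degH)
    then obtain A N where AN: "A \<subseteq> ?U \<and> N \<subseteq> ?V \<or> A \<subseteq> ?V \<and> N \<subseteq> ?U" "card A = k - q" "card N \<le> k - q"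
        "R `` A \<subseteq> N"
      by (elim exE conjE)
    have inN: "v \<in> N" if "a \<in> A" "(a, v) \<in> parcs G" "v \<notin> S" for a v
    proof -
      have "a \<notin> S" using AN(1) that(1) by auto
      then have "(a, v) \<in> R" unfolding R using that by simp
      then show ?thesis using AN(4) that(1) by blast
    qed
    have "balanced_bipartite G V U" using assms(1) unfolding balanced_bipartite_def by auto
    from AN(1) have "subgraph_up_to_iso G (F_graph n k (int q + 1))"
    proof
      assume "A \<subseteq> ?U \<and> N \<subseteq> ?V"
      then show ?thesis
        using AN(2,3) inN by (intro tight_set_embeds[OF assms(1) cU kn qk SV]) auto
    next
      assume "A \<subseteq> ?V \<and> N \<subseteq> ?U"
      then show ?thesis
        using AN(2,3) inN
        by (intro tight_set_embeds[OF \<open>balanced_bipartite G V U\<close> cV kn qk SU]) auto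
    qed
    then show False using assms(9) by blast
  qed
  moreover have "card (pverts ?H) = 2 * (n - q)"
    unfolding WH using fin dis cUS cVS by (subst card_Un_disjoint) auto
  then have "3 \<le> card (pverts ?H)" using two unfolding cUS by linarith
  ultimately show "has_spanning_cycle ?H" unfolding WH[symmetric] R_def by (rule has_spanning_cycleI)
qed

end
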